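(* For every $n \in \mathbb{N}$ let $Y_n : NC^{\mathrm{(mton)}}(n) \to \mathbb{N}$ be the random variable $Y_n(\pi,u) := |\pi|$ (the number of blocks of $\pi$), where $NC^{\mathrm{(mton)}}(n)$ carries the uniform probability distribution. Then: (1) $E[Y_n] = n - H_n + \frac{3}{2} - \frac{1}{n+1}$ for all $n \geq 2$; consequently $E[Y_n] \approx (n - \ln n) + \bigl(\frac{3}{2} - \gamma\bigr)$ as $n \to \infty$. (2) $\mathrm{Var}[Y_n] = H_n - H_n^{(2)} - \frac{(n-1)^2}{4(n+1)^2}$ for all $n \geq 2$; consequently $\mathrm{Var}[Y_n] \approx \ln n - \bigl(\frac{\pi^2}{6} + \frac{1}{4} - \gamma\bigr)$ as $n \to \infty$.
   Context: $NC(n)$ is the set of non-crossing partitions of $\{1,\ldots,n\}$. For $\pi \in NC(n)$ and blocks $V,W \in \pi$, "$V$ is nested inside $W$" means $\min V > \min W$ and $\max V < \max W$. A monotonic ordering of $\pi$ is a bijection $u : \pi \to \{1,\ldots,|\pi|\}$ such that $u(V) > u(W)$ whenever $V$ is nested inside $W$. $NC^{\mathrm{(mton)}}(n)$ is the set of pairs $(\pi,u)$ with $\pi \in NC(n)$ and $u$ a monotonic ordering of $\pi$. $H_n = \sum_{k=1}^n 1/k$, $H_n^{(2)} = \sum_{k=1}^n 1/k^2$, $\gamma$ is the Euler–Mascheroni constant, and $a_n \approx b_n$ means $a_n - b_n \to 0$ as $n \to \infty$. *)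

theory Defs
  imports "HOL-Probability.Probability"
begin

definition noncrossing :: "nat set set \<Rightarrow> bool" where
  "noncrossing \<pi> \<longleftrightarrow>
     (\<forall>V\<in>\<pi>. \<forall>W\<in>\<pi>. V \<noteq> W \<longrightarrow>
        \<not> (\<exists>a b c d. a < b \<and> b < c \<and> c < d \<and> a \<in> V \<and> c \<in> V \<and> b \<in> W \<and> d \<in> W))"

definition NC :: "nat \<Rightarrow> nat set set set" where
  "NC n = {\<pi>. partition_on {1..n} \<pi> \<and> noncrossing \<pi>}"

definition nested_inside :: "nat set \<Rightarrow> nat set \<Rightarrow> bool" where
  "nested_inside V W \<longleftrightarrow> Min V > Min W \<and> Max V < Max W"

(* A function on the set of blocks is encoded as a HOL function that is undefined
   outside of it (extensional), so that each monotonic ordering is counted exactly once. *)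
definition monotonic_ordering :: "nat set set \<Rightarrow> (nat set \<Rightarrow> nat) \<Rightarrow> bool" where
  "monotonic_ordering \<pi> u \<longleftrightarrow>
     u \<in> extensional \<pi> \<and> bij_betw u \<pi> {1..card \<pi>} \<and>
     (\<forall>V\<in>\<pi>. \<forall>W\<in>\<pi>. nested_inside V W \<longrightarrow> u V > u W)"

definition NC_mton :: "nat \<Rightarrow> (nat set set \<times> (nat set \<Rightarrow> nat)) set" where
  "NC_mton n = {(\<pi>, u). \<pi> \<in> NC n \<and> monotonic_ordering \<pi> u}"

definition Y :: "nat set set \<times> (nat set \<Rightarrow> nat) \<Rightarrow> nat" where
  "Y = (\<lambda>(\<pi>, u). card \<pi>)"

definition EY :: "nat \<Rightarrow> real" where
  "EY n = measure_pmf.expectation (pmf_of_set (NC_mton n)) (\<lambda>x. real (Y x))"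

definition VarY :: "nat \<Rightarrow> real" where
  "VarY n = measure_pmf.variance (pmf_of_set (NC_mton n)) (\<lambda>x. real (Y x))"

definition harm2 :: "nat \<Rightarrow> real" where
  "harm2 n = (\<Sum>k=1..n. 1 / real k ^ 2)"

definition seq_approx :: "(nat \<Rightarrow> real) \<Rightarrow> (nat \<Rightarrow> real) \<Rightarrow> bool" where
  "seq_approx a b \<longleftrightarrow> (\<lambda>n. a n - b n) \<longlonglongrightarrow> 0"

(* pmf_of_set is the uniform distribution only on finite non-empty sets. *)
lemma finite_NC_mton: "finite (NC_mton n)"
proof -
  have "NC_mton n \<subseteq> Sigma (Pow (Pow {1..n})) (\<lambda>\<pi>. \<pi> \<rightarrow>\<^sub>E {1..card \<pi>})"
    by (auto simp: NC_mton_def NC_def monotonic_ordering_def partition_on_def PiE_def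
        dest: bij_betw_apply)
  moreover have "finite (Sigma (Pow (Pow {1..n})) (\<lambda>\<pi>. \<pi> \<rightarrow>\<^sub>E {1..card \<pi>}))"
    by (intro finite_SigmaI finite_PiE) (auto dest: finite_subset[OF _ finite_Pow_iff[THEN iffD2, OF finite_atLeastAtMost]])
  ultimately show ?thesis by (rule finite_subset)
qed

lemma NC_mton_nonempty:
  assumes "n \<ge> 1"
  shows "NC_mton n \<noteq> {}"
proof -
  have "({{1..n}}, \<lambda>V\<in>{{1..n}}. 1) \<in> NC_mton n"
    using assms by (auto simp: NC_mton_def NC_def monotonic_ordering_def partition_on_def
        noncrossing_def nested_inside_def bij_betw_def)
  thus ?thesis by blast
qed

end

theory Submission
  imports Defs "HOL-Library.Sublist" "HOL-Real_Asymp.Real_Asymp"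
begin

text \<open>
  A pair (\<pi>, u) is the same as the word w of length n whose i-th letter is the label u(V) of the
  block V containing i. In terms of w, non-crossing and monotonicity together say that no letter
  smaller than x occurs between two occurrences of x. In such a word the occurrences of the largest
  letter are consecutive, so a word of length n + 1 arises from a unique word of length n, either by
  inserting a new largest letter at one of n + 1 places, or by doubling the first occurrence of the
  largest letter. The generating polynomial of the number of blocks is therefore multiplied by
  1 + (n + 1) t when passing from n to n + 1, that is, the number of blocks gains an independent
  Bernoulli variable with parameter (n + 1) / (n + 2).
\<close>

section \<open>Valley-free words and their extension by one letter\<close>

definition valley_free :: "nat list \<Rightarrow> bool" where
  "valley_free w \<longleftrightarrow> (\<forall>x y. subseq [x, y, x] w \<longrightarrow> x \<le> y)"

definition words :: "nat \<Rightarrow> nat list set" where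
  "words n = {w. length w = n \<and> set w = {1..card (set w)} \<and> valley_free w}"

text \<open>Letters of a word in \<open>words n\<close> fill an interval starting at 1, so
  \<open>card (set w)\<close> is the largest letter and its successor is new. Every \<open>i\<close>
  beyond the length appends; distinct places are those with \<open>i \<le> n\<close>.\<close>

definition insert_top :: "nat \<Rightarrow> nat list \<Rightarrow> nat list" where
  "insert_top i w = take i w @ Suc (card (set w)) # drop i w"

text \<open>The copy goes directly before the first occurrence of the largest letter. The empty word
  has no such letter, whence the condition \<open>n > 0\<close> further on.\<close>

definition double_top :: "nat list \<Rightarrow> nat list" where
  "double_top w = takeWhile (\<lambda>x. x \<noteq> card (set w)) w @ card (set w) # dropWhile (\<lambda>x. x \<noteq> card (set w)) w"

lemma valley_free_subseq: "valley_free w \<Longrightarrow> subseq v w \<Longrightarrow> valley_free v"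
  unfolding valley_free_def using subseq_order.trans by blast

lemma subseq_imp_set_subset: "subseq xs ys \<Longrightarrow> set xs \<subseteq> set ys"
  by (auto elim: list_emb_set)

lemma subseq_filter_mono:
  assumes "subseq xs ys" and "\<forall>x\<in>set xs. P x"
  shows "subseq xs (filter P ys)"
proof -
  have "subseq (filter P xs) (filter P ys)" using assms(1) by (rule subseq_filter)
  moreover have "filter P xs = xs" using assms(2) by simp
  ultimately show ?thesis by simp
qed

text \<open>In a pattern x y x the new letter k cannot be x with y different from it, since k occurs
  only once; as y it is harmless, being maximal. Patterns avoiding k survive in the word without
  k.\<close>

lemma valley_free_insert_max:
  assumes "valley_free (us @ vs)" and "\<forall>x\<in>set (us @ vs). x < k"
  shows "valley_free (us @ k # vs)"
  unfolding valley_free_def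
proof (intro allI impI)
  fix x y assume sub: "subseq [x, y, x] (us @ k # vs)"
  have "set [x, y, x] \<subseteq> set (us @ k # vs)"
    using sub by (rule subseq_imp_set_subset)
  hence "x \<le> k" "y \<le> k" using assms(2) by (auto intro: less_imp_le)
  show "x \<le> y"
  proof (cases "x = k \<or> y = k")
    case False
    hence "subseq [x, y, x] (filter (\<lambda>z. z \<noteq> k) (us @ k # vs))"
      using sub by (intro subseq_filter_mono) auto
    moreover have "filter (\<lambda>z. z \<noteq> k) us = us" "filter (\<lambda>z. z \<noteq> k) vs = vs"
      using assms(2) by (auto simp: filter_id_conv)
    hence "filter (\<lambda>z. z \<noteq> k) (us @ k # vs) = us @ vs" by simp
    ultimately show ?thesis using assms(1) by (auto simp: valley_free_def)
  next
    case True
    show ?thesis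
    proof (cases "x = k \<and> y \<noteq> k")
      case True
      hence "subseq [k, k] [x, y, x]" by simp
      hence "subseq [k, k] (us @ k # vs)" using sub by (rule subseq_order.order_trans)
      hence "subseq [k, k] (filter (\<lambda>z. z = k) (us @ k # vs))"
        by (intro subseq_filter_mono) auto
      moreover have "filter (\<lambda>z. z = k) us = []" "filter (\<lambda>z. z = k) vs = []"
        using assms(2) by (auto simp: filter_empty_conv)
      ultimately show ?thesis by simp
    qed (use True \<open>x \<le> k\<close> \<open>y \<le> k\<close> in auto)
  qed
qed

lemma subseq_Cons_append_notin:
  "x \<notin> set us \<Longrightarrow> subseq (x # xs) (us @ vs) \<longleftrightarrow> subseq (x # xs) vs"
  by (induction us) auto

text \<open>Only a pattern k y k with y different from k could be dangerous. As the two copies are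
  adjacent and no k precedes them, y and the last k lie in \<open>vs\<close>, so one copy already
  gives the pattern in the old word.\<close>

lemma valley_free_double_max:
  assumes "valley_free (us @ k # vs)" and "\<forall>x\<in>set (us @ k # vs). x \<le> k" and "k \<notin> set us"
  shows "valley_free (us @ k # k # vs)"
  unfolding valley_free_def
proof (intro allI impI)
  fix x y assume sub: "subseq [x, y, x] (us @ k # k # vs)"
  have "set [x, y, x] \<subseteq> set (us @ k # k # vs)"
    using sub by (rule subseq_imp_set_subset)
  hence "x \<le> k" "y \<le> k" using assms(2) by auto
  show "x \<le> y"
  proof (cases "x = k")
    case False
    show ?thesis
    proof (cases "y = k")
      case False
      hence "subseq [x, y, x] (filter (\<lambda>z. z \<noteq> k) (us @ k # k # vs))"
        using \<open>x \<noteq> k\<close> sub by (intro subseq_filter_mono) auto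
      also have "filter (\<lambda>z. z \<noteq> k) (us @ k # k # vs) = filter (\<lambda>z. z \<noteq> k) (us @ k # vs)" by simp
      finally have "subseq [x, y, x] (us @ k # vs)"
        using subseq_filter_left subseq_order.trans by blast
      thus ?thesis using assms(1) by (auto simp: valley_free_def)
    qed (use \<open>x \<le> k\<close> in auto)
  next
    case True
    show ?thesis
    proof (cases "y = k")
      case False
      have "subseq [k, y, k] (k # k # vs)"
        using sub True assms(3) by (simp add: subseq_Cons_append_notin)
      hence "subseq [y, k] vs" using False by simp
      hence "subseq [k, y, k] (us @ k # vs)" by (simp add: list_emb_append2)
      hence "k \<le> y" using assms(1) by (auto simp: valley_free_def)
      thus ?thesis using True by simp
    qed (use True in auto)
  qed
qed

lemma insert_top_words:
  assumes "w \<in> words n"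
  shows "insert_top i w \<in> words (Suc n)" and "card (set (insert_top i w)) = Suc (card (set w))"
proof -
  have w: "length w = n" "set w = {1..card (set w)}" "valley_free w"
    using assms by (auto simp: words_def)
  have "set (insert_top i w) = insert (Suc (card (set w))) (set (take i w) \<union> set (drop i w))"
    unfolding insert_top_def by simp
  also have "set (take i w) \<union> set (drop i w) = set w"
    by (metis append_take_drop_id set_append)
  also have "insert (Suc (card (set w))) (set w) = insert (Suc (card (set w))) {1..card (set w)}"
    using w(2) by (rule arg_cong)
  also have "\<dots> = {1..Suc (card (set w))}" by auto
  finally have s': "set (insert_top i w) = {1..Suc (card (set w))}" .
  thus c: "card (set (insert_top i w)) = Suc (card (set w))" by simp
  have "valley_free (insert_top i w)" unfolding insert_top_def
  proof (rule valley_free_insert_max)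
    have "x < Suc (card (set w))" if "x \<in> set w" for x
      using w(2) that by (metis atLeastAtMost_iff less_Suc_eq_le)
    thus "\<forall>x\<in>set (take i w @ drop i w). x < Suc (card (set w))" by simp
  qed (use w(3) in simp)
  moreover have "length (insert_top i w) = Suc n" using w(1) by (simp add: insert_top_def)
  ultimately show "insert_top i w \<in> words (Suc n)"
    using s' c by (simp add: words_def)
qed

lemma words_split_top:
  assumes "w \<in> words n" "n > 0"
  obtains us vs where "w = us @ card (set w) # vs" "card (set w) \<notin> set us"
    "double_top w = us @ card (set w) # card (set w) # vs"
proof -
  have w: "length w = n" "set w = {1..card (set w)}"
    using assms by (auto simp: words_def)
  have "card (set w) > 0" using w(1) assms(2) by (auto simp: card_gt_0_iff)
  hence "card (set w) \<in> set w" using w(2) by (metis atLeastAtMost_iff le_refl Suc_leI One_nat_def)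
  then obtain us vs where *: "w = us @ card (set w) # vs" "card (set w) \<notin> set us"
    by (meson split_list_first)
  define k where "k = card (set w)"
  have "w = us @ k # vs" "k \<notin> set us" using * unfolding k_def by auto
  hence "takeWhile (\<lambda>x. x \<noteq> k) w = us" "dropWhile (\<lambda>x. x \<noteq> k) w = k # vs"
    by (simp_all add: takeWhile_append dropWhile_append) 
  hence "double_top w = us @ k # k # vs" unfolding double_top_def k_def by simp
  with * show ?thesis using that unfolding k_def by blast
qed

lemma double_top_words:
  assumes "w \<in> words n" "n > 0"
  shows "double_top w \<in> words (Suc n)" and "card (set (double_top w)) = card (set w)"
proof -
  obtain us vs where *: "w = us @ card (set w) # vs" "card (set w) \<notin> set us"
    "double_top w = us @ card (set w) # card (set w) # vs"
    using words_split_top[OF assms] by blast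
  define k where "k = card (set w)"
  note * = *[folded k_def]
  have w: "length w = n" "set w = {1..k}" "valley_free w"
    using assms by (auto simp: words_def k_def)
  have s: "set (double_top w) = set w" using *(1,3) by (metis insert_absorb2 list.set(2) set_append)
  thus "card (set (double_top w)) = card (set w)" by simp
  have "valley_free (us @ k # k # vs)"
    by (rule valley_free_double_max) (use * w in auto)
  moreover have "length (double_top w) = Suc n" using w(1) *(1,3) by simp
  ultimately show "double_top w \<in> words (Suc n)"
    using s w *(3) by (simp add: words_def)
qed

section \<open>Unique reconstruction of the shorter word, and the recursion in the length\<close>

text \<open>The inserted letter differs from all others: deleting it gives back \<open>w\<close>,
  and the length of the prefix before it gives back \<open>i\<close>.\<close>

lemma remove1_insert_top:
  assumes "w \<in> words n"
  shows "remove1 (Suc (card (set w))) (insert_top i w) = w"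
    and "i \<le> n \<Longrightarrow> length (takeWhile (\<lambda>x. x \<noteq> Suc (card (set w))) (insert_top i w)) = i"
    and "count_list (insert_top i w) (Suc (card (set w))) = 1"
proof -
  define k where "k = Suc (card (set w))"
  have w: "length w = n" "set w = {1..card (set w)}"
    using assms by (auto simp: words_def)
  have k: "k \<notin> set w" using w(2) unfolding k_def by (metis atLeastAtMost_iff not_less_eq_eq order_refl)
  hence k': "k \<notin> set (take i w)" "k \<notin> set (drop i w)"
    by (meson in_set_takeD in_set_dropD)+
  show "remove1 (Suc (card (set w))) (insert_top i w) = w"
    using k' by (simp add: insert_top_def remove1_append flip: k_def)
  show "length (takeWhile (\<lambda>x. x \<noteq> Suc (card (set w))) (insert_top i w)) = i" if "i \<le> n"
    using k' that w(1) by (auto simp: insert_top_def takeWhile_append simp flip: k_def)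
  show "count_list (insert_top i w) (Suc (card (set w))) = 1"
    using k' by (simp add: insert_top_def count_list_0_iff flip: k_def)
qed

lemma remove1_double_top:
  assumes "w \<in> words n" "n > 0"
  shows "remove1 (card (set w)) (double_top w) = w"
    and "count_list (double_top w) (card (set w)) \<ge> 2"
proof -
  obtain us vs where *: "w = us @ card (set w) # vs" "card (set w) \<notin> set us"
    "double_top w = us @ card (set w) # card (set w) # vs"
    using words_split_top[OF assms] by blast
  define k where "k = card (set w)"
  note * = *[folded k_def]
  show "remove1 (card (set w)) (double_top w) = w"
    unfolding k_def[symmetric] *(3) using *(1,2) by (simp add: remove1_append)
  show "count_list (double_top w) (card (set w)) \<ge> 2"
    unfolding k_def[symmetric] *(3) by simp
qed

lemma inj_on_insert_top: "inj_on (\<lambda>(i, w). insert_top i w) ({..n} \<times> words n)"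
proof (rule inj_onI)
  fix p q
  assume pq: "p \<in> {..n} \<times> words n" "q \<in> {..n} \<times> words n"
    "(\<lambda>(i, w). insert_top i w) p = (\<lambda>(i, w). insert_top i w) q"
  obtain i w j v where p: "p = (i, w)" "q = (j, v)" by (metis surj_pair)
  have a: "i \<in> {..n}" "w \<in> words n" "j \<in> {..n}" "v \<in> words n"
    and eq: "insert_top i w = insert_top j v"
    using pq p by auto
  have c: "card (set w) = card (set v)"
    using insert_top_words(2)[of w n i] insert_top_words(2)[of v n j] a eq by simp
  have "w = v"
    using remove1_insert_top(1)[OF a(2), of i] remove1_insert_top(1)[OF a(4), of j]
    unfolding eq c by (rule trans[OF sym])
  moreover have "i = j"
    using remove1_insert_top(2)[OF a(2), of i] remove1_insert_top(2)[OF a(4), of j] a(1,3)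
    unfolding eq c atMost_iff by metis
  ultimately show "p = q" using p by simp
qed

lemma inj_on_double_top: "n > 0 \<Longrightarrow> inj_on double_top (words n)"
  by (rule inj_onI) (metis remove1_double_top(1) double_top_words(2))

text \<open>After an insertion the largest letter occurs exactly once, after a doubling at least
  twice.\<close>

lemma insert_top_neq_double_top:
  assumes "w \<in> words n" "v \<in> words n" "n > 0"
  shows "insert_top i w \<noteq> double_top v"
proof
  assume eq: "insert_top i w = double_top v"
  have "Suc (card (set w)) = card (set v)"
    using insert_top_words(2)[OF assms(1), of i] double_top_words(2)[OF assms(2,3)] eq by simp
  thus False
    using remove1_insert_top(3)[OF assms(1), of i] remove1_double_top(2)[OF assms(2,3)] eq by simp
qed

text \<open>Removing the first occurrence of the largest letter k inverts one of the two operations: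
  an insertion if k occurs only once, a doubling otherwise.\<close>

lemma words_Suc:
  assumes "n > 0"
  shows "words (Suc n) = (\<lambda>(i, w). insert_top i w) ` ({..n} \<times> words n) \<union> double_top ` words n"
    (is "_ = ?R")
proof
  show "?R \<subseteq> words (Suc n)"
    using insert_top_words(1) double_top_words(1) assms by auto
  show "words (Suc n) \<subseteq> ?R"
  proof
    fix w assume w: "w \<in> words (Suc n)"
    define k where "k = card (set w)"
    have l: "length w = Suc n" and s: "set w = {1..k}" and vf: "valley_free w"
      using w by (auto simp: words_def k_def)
    have kpos: "k > 0" using l unfolding k_def by (auto simp: card_gt_0_iff)
    obtain us vs where us: "w = us @ k # vs" "k \<notin> set us"
      using words_split_top[OF w] unfolding k_def by blast
    have vf': "valley_free (us @ vs)"
      by (rule valley_free_subseq[OF vf]) (simp add: us(1) list_emb_append_mono list_emb_Cons)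
    show "w \<in> ?R"
    proof (cases "k \<in> set vs")
      case False
      have "set (us @ vs) = set w - {k}" using us False by auto
      also have "\<dots> = {1..k - 1}" unfolding s using kpos by (cases k) auto
      finally have s': "set (us @ vs) = {1..k - 1}" .
      have *: "us @ vs \<in> words n" unfolding words_def using l us(1) s' vf' by simp
      have "w = insert_top (length us) (us @ vs)"
        unfolding insert_top_def s' using us(1) kpos by simp
      moreover have "length us \<le> n" using l us(1) by simp
      ultimately show ?thesis using * by force
    next
      case True
      obtain xs ys where xs: "vs = xs @ k # ys" "k \<notin> set xs" using split_list_first[OF True] by blast
      \<comment> \<open>The first two occurrences of k are adjacent: a letter y between them would
        satisfy k \<le> y by valley-freeness, hence y = k, although \<open>xs\<close> contains no
        k.\<close>
      have "xs = []"
      proof (cases xs)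
        case (Cons y xs')
        have "subseq [k, y, k] w" unfolding us(1) xs(1) Cons
          by (simp add: list_emb_append2)
        hence "k \<le> y" using vf by (auto simp: valley_free_def)
        moreover have "y \<in> set w" using us(1) xs(1) Cons by auto
        ultimately show ?thesis using s xs(2) Cons by auto
      qed simp
      hence vs: "vs = k # ys" using xs by simp
      have s': "set (us @ vs) = {1..k}" unfolding s[symmetric] us(1) vs by auto
      have *: "us @ vs \<in> words n" unfolding words_def using l us(1) s' vf' by simp
      have "w = double_top (us @ vs)"
        unfolding double_top_def s' using us vs by (simp add: takeWhile_append dropWhile_append)
      thus ?thesis using * by blast
    qed
  qed
qed

lemma finite_words: "finite (words n)"
proof (rule finite_subset)
  show "words n \<subseteq> {w. set w \<subseteq> {1..n} \<and> length w = n}"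
  proof
    fix w assume "w \<in> words n"
    hence w: "length w = n" "set w = {1..card (set w)}" by (auto simp: words_def)
    have "card (set w) \<le> n" using card_length[of w] w(1) by simp
    hence "{1..card (set w)} \<subseteq> {1..n}" by simp
    hence "set w \<subseteq> {1..n}" using w(2) by (rule ssubst[rotated])
    thus "w \<in> {w. set w \<subseteq> {1..n} \<and> length w = n}" using w(1) by blast
  qed
qed (simp add: finite_lists_length_eq)

text \<open>An arbitrary weight \<open>g\<close> replaces the generating polynomial: the constant 1
  yields the number of words, powers yield the moments.\<close>

lemma sum_words_Suc:
  fixes g :: "nat \<Rightarrow> real"
  assumes "n > 0"
  shows "(\<Sum>w\<in>words (Suc n). g (card (set w))) =
    (\<Sum>w\<in>words n. g (card (set w)) + (real n + 1) * g (Suc (card (set w))))"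
proof -
  let ?I = "(\<lambda>(i, w). insert_top i w) ` ({..n} \<times> words n)" and ?D = "double_top ` words n"
  have "(\<Sum>w\<in>words (Suc n). g (card (set w))) =
      (\<Sum>w\<in>?I. g (card (set w))) + (\<Sum>w\<in>?D. g (card (set w)))"
    unfolding words_Suc[OF assms]
    by (rule sum.union_disjoint) (use finite_words insert_top_neq_double_top assms in auto)
  also have "(\<Sum>w\<in>?I. g (card (set w))) =
      (\<Sum>(i, w)\<in>{..n} \<times> words n. g (card (set (insert_top i w))))"
    by (subst sum.reindex[OF inj_on_insert_top]) (simp add: case_prod_unfold)
  also have "\<dots> = (\<Sum>(i, w)\<in>{..n} \<times> words n. g (Suc (card (set w))))"
    by (rule sum.cong) (auto simp: insert_top_words(2))
  also have "\<dots> = (\<Sum>w\<in>words n. (real n + 1) * g (Suc (card (set w))))"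
    by (simp add: sum.cartesian_product[symmetric] sum_distrib_left algebra_simps)
  also have "(\<Sum>w\<in>?D. g (card (set w))) = (\<Sum>w\<in>words n. g (card (set w)))"
    by (subst sum.reindex[OF inj_on_double_top[OF assms]])
       (auto intro!: sum.cong simp: double_top_words(2)[OF _ assms])
  finally show ?thesis by (simp add: sum.distrib)
qed

lemma words_1: "words 1 = {[1]}"
proof -
  have "valley_free [Suc 0]" by (auto simp: valley_free_def)
  thus ?thesis by (auto simp: words_def length_Suc_conv)
qed

section \<open>Bijection between words and monotonically ordered non-crossing partitions\<close>

text \<open>Peeling off one letter at a time turns the subsequence form of valley-freeness,
  convenient for editing words, into a statement on positions, which are the elements of the
  blocks.\<close>

lemma subseq_Cons_iff_nth:
  "subseq (x # xs) w \<longleftrightarrow> (\<exists>a<length w. w ! a = x \<and> subseq xs (drop (Suc a) w))"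
proof
  assume "subseq (x # xs) w"
  then obtain us vs where *: "w = us @ x # vs" "subseq xs vs"
    by (auto elim!: list_emb_ConsD[elim_format])
  thus "\<exists>a<length w. w ! a = x \<and> subseq xs (drop (Suc a) w)"
    by (intro exI[of _ "length us"]) simp
next
  assume "\<exists>a<length w. w ! a = x \<and> subseq xs (drop (Suc a) w)"
  then obtain a where a: "a < length w" "w ! a = x" "subseq xs (drop (Suc a) w)" by blast
  have "subseq (x # xs) (take a w @ w ! a # drop (Suc a) w)"
    using a by (intro list_emb_append2) simp
  thus "subseq (x # xs) w" using id_take_nth_drop[OF a(1)] by simp
qed

lemma valley_free_iff_nth:
  "valley_free w \<longleftrightarrow>
    (\<forall>a b c. a < b \<and> b < c \<and> c < length w \<and> w ! a = w ! c \<longrightarrow> w ! a \<le> w ! b)"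
proof (intro iffI allI impI)
  fix a b c
  assume vf: "valley_free w" and *: "a < b \<and> b < c \<and> c < length w \<and> w ! a = w ! c"
  have "subseq [w ! c] (drop (Suc b) w)"
    unfolding subseq_Cons_iff_nth using * by (intro exI[of _ "c - Suc b"]) auto
  hence "subseq [w ! b, w ! c] (drop (Suc a) w)"
    by (subst subseq_Cons_iff_nth, intro exI[of _ "b - Suc a"]) (use * in auto)
  hence "subseq [w ! a, w ! b, w ! c] w"
    by (subst subseq_Cons_iff_nth, intro exI[of _ a]) (use * in auto)
  thus "w ! a \<le> w ! b" using vf * unfolding valley_free_def by metis
next
  assume *: "\<forall>a b c. a < b \<and> b < c \<and> c < length w \<and> w ! a = w ! c \<longrightarrow> w ! a \<le> w ! b"
  show "valley_free w" unfolding valley_free_def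
  proof (intro allI impI)
    fix x y assume "subseq [x, y, x] w"
    then obtain a b c where abc: "a < length w" "w ! a = x"
      "b < length (drop (Suc a) w)" "drop (Suc a) w ! b = y"
      "c < length (drop (Suc b) (drop (Suc a) w))" "drop (Suc b) (drop (Suc a) w) ! c = x"
      unfolding subseq_Cons_iff_nth by blast
    \<comment> \<open>Each index is relative to the suffix left by the previous one, so the absolute
      positions are sums with one added per letter consumed.\<close>
    show "x \<le> y"
      using *[rule_format, of a "Suc a + b" "Suc a + (Suc b + c)"] abc by (auto simp: ac_simps)
  qed
qed

text \<open>Blocks live in 1..n while list positions start at 0, hence the shift by one.\<close>

definition level_set :: "nat list \<Rightarrow> nat \<Rightarrow> nat set" where
  "level_set w j = {i \<in> {1..length w}. w ! (i - 1) = j}"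

text \<open>The word is constant on a block, so its label can be read at any element; the minimum is
  a canonical choice. The restriction makes the labelling extensional.\<close>

definition partition_of :: "nat list \<Rightarrow> nat set set \<times> (nat set \<Rightarrow> nat)" where
  "partition_of w =
    (level_set w ` set w, restrict (\<lambda>V. w ! (Min V - 1)) (level_set w ` set w))"

lemma finite_level_set [simp]: "finite (level_set w j)"
  by (simp add: level_set_def)

lemma level_set_nonempty: "j \<in> set w \<Longrightarrow> level_set w j \<noteq> {}"
proof -
  assume "j \<in> set w"
  then obtain i where "i < length w" "w ! i = j" by (auto simp: in_set_conv_nth)
  hence "Suc i \<in> level_set w j" by (auto simp: level_set_def)
  thus ?thesis by blast
qed

lemma nth_Min_level_set:
  assumes "j \<in> set w"
  shows "w ! (Min (level_set w j) - 1) = j"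
  using Min_in[OF finite_level_set level_set_nonempty[OF assms]] by (simp add: level_set_def)

lemma level_set_inj: "inj_on (level_set w) (set w)"
  by (rule inj_onI) (metis nth_Min_level_set)

lemma valley_free_level_set:
  assumes "valley_free w" "a \<in> level_set w x" "b \<in> level_set w y" "c \<in> level_set w x"
    and "a < b" "b < c"
  shows "x \<le> y"
proof -
  have "w ! (a - 1) \<le> w ! (b - 1)"
    using assms by (intro assms(1)[unfolded valley_free_iff_nth, rule_format, of _ _ "c - 1"])
      (auto simp: level_set_def)
  thus ?thesis using assms by (simp add: level_set_def)
qed

text \<open>A crossing of the blocks of x and y contains both patterns x y x and y x y, forcing x =
  y. If the block V of x is nested in the block W of y, then \<open>Min V\<close> lies between
  \<open>Min W\<close> and \<open>Max W\<close>, giving the pattern y x y and thus y < x.\<close>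

lemma partition_of_words:
  assumes "w \<in> words n"
  shows "partition_of w \<in> NC_mton n"
proof -
  let ?\<pi> = "level_set w ` set w"
  let ?u = "restrict (\<lambda>V. w ! (Min V - 1)) ?\<pi>"
  have w: "length w = n" "set w = {1..card (set w)}" "valley_free w"
    using assms by (auto simp: words_def)
  have u: "?u (level_set w j) = j" if "j \<in> set w" for j
    using nth_Min_level_set that by simp
  have card: "card ?\<pi> = card (set w)" by (rule card_image[OF level_set_inj])
  have part: "partition_on {1..n} ?\<pi>"
  proof (rule partition_onI)
    show "\<Union>?\<pi> = {1..n}"
    proof
      show "\<Union>?\<pi> \<subseteq> {1..n}" using w(1) by (auto simp: level_set_def)
      show "{1..n} \<subseteq> \<Union>?\<pi>"
      proof
        fix i assume i: "i \<in> {1..n}"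
        hence "w ! (i - 1) \<in> set w" using w(1) by auto
        thus "i \<in> \<Union>?\<pi>" using i w(1) by (auto simp: level_set_def)
      qed
    qed
  qed (use level_set_nonempty in \<open>auto simp: level_set_def disjnt_def\<close>)
  have "noncrossing ?\<pi>"
    unfolding noncrossing_def
  proof (intro ballI impI notI, elim exE conjE)
    fix V W a b c d
    assume VW: "V \<in> ?\<pi>" "W \<in> ?\<pi>" "V \<noteq> W"
      and *: "a < b" "b < c" "c < d" "a \<in> V" "c \<in> V" "b \<in> W" "d \<in> W"
    obtain x y where xy: "V = level_set w x" "W = level_set w y" using VW by blast
    have "x \<le> y" using valley_free_level_set[OF w(3)] * xy by blast
    moreover have "y \<le> x" using valley_free_level_set[OF w(3)] * xy by blast
    ultimately show False using xy VW by simp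
  qed
  moreover have "bij_betw ?u ?\<pi> {1..card ?\<pi>}"
    unfolding bij_betw_def
  proof
    show "inj_on ?u ?\<pi>" using u by (auto intro!: inj_onI)
    have "?u ` ?\<pi> = set w" using u by (auto simp: image_image cong: image_cong)
    thus "?u ` ?\<pi> = {1..card ?\<pi>}" using card w(2) by simp
  qed
  moreover have "?u W < ?u V" if VW: "V \<in> ?\<pi>" "W \<in> ?\<pi>" and nest: "nested_inside V W" for V W
  proof -
    obtain x y where xy: "x \<in> set w" "y \<in> set w" "V = level_set w x" "W = level_set w y"
      using VW by blast
    note ne = level_set_nonempty[OF xy(1)] level_set_nonempty[OF xy(2)]
    have lt: "Min W < Min V" "Max V < Max W" using nest by (auto simp: nested_inside_def)
    have "Min V \<le> Max V" using ne xy by simp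
    hence "Min V < Max W" using lt by simp
    have "y \<le> x"
    proof (rule valley_free_level_set[OF w(3) _ _ _ lt(1) \<open>Min V < Max W\<close>])
      show "Min W \<in> level_set w y" "Min V \<in> level_set w x" "Max W \<in> level_set w y"
        using ne xy by (auto intro: Min_in Max_in)
    qed
    moreover have "x \<noteq> y" using lt xy by auto
    ultimately show ?thesis using u xy by simp
  qed
  ultimately show ?thesis
    using part by (simp add: partition_of_def NC_mton_def NC_def monotonic_ordering_def)
qed

text \<open>The block containing \<open>Suc i\<close> is the same for both words, and the common
  label function sends it to the letter at index \<open>i\<close> of either word.\<close>

lemma inj_on_partition_of: "inj_on partition_of (words n)"
proof (rule inj_onI)
  fix w v assume w: "w \<in> words n" and v: "v \<in> words n" and eq: "partition_of w = partition_of v"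
  have l: "length w = n" "length v = n" using w v by (auto simp: words_def)
  show "w = v"
  proof (rule nth_equalityI)
    fix i assume i: "i < length w"
    let ?V = "level_set w (w ! i)"
    have V: "?V \<in> level_set w ` set w" using i by simp
    have eq1: "level_set w ` set w = level_set v ` set v"
      using eq by (simp add: partition_of_def)
    then obtain j where j: "j \<in> set v" "?V = level_set v j" using V by blast
    have "Suc i \<in> ?V" using i by (simp add: level_set_def)
    hence "Suc i \<in> level_set v j" using j(2) by blast
    hence "v ! i = j" by (simp add: level_set_def)
    have "snd (partition_of w) ?V = w ! i"
      using V i nth_Min_level_set[of "w ! i" w] by (simp add: partition_of_def)
    moreover have "snd (partition_of v) (level_set v j) = j"
      using j nth_Min_level_set[of j v] by (simp add: partition_of_def)
    ultimately show "w ! i = v ! i" using eq j \<open>v ! i = j\<close> by simp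
  qed (use l in simp)
qed

text \<open>The preimage writes at each position the label of the block \<open>B i\<close>
  containing it. For a pattern with outer block V and middle block W, non-crossing confines W
  between the two elements of V, so W is nested inside V and carries the larger label.\<close>

lemma partition_of_surj:
  assumes "(\<pi>, u) \<in> NC_mton n"
  shows "(\<pi>, u) \<in> partition_of ` words n"
proof -
  have part: "partition_on {1..n} \<pi>" and nc: "noncrossing \<pi>"
    and ext: "u \<in> extensional \<pi>" and bij: "bij_betw u \<pi> {1..card \<pi>}"
    and mono: "\<And>V W. V \<in> \<pi> \<Longrightarrow> W \<in> \<pi> \<Longrightarrow> nested_inside V W \<Longrightarrow> u W < u V"
    using assms by (auto simp: NC_mton_def NC_def monotonic_ordering_def)
  define B where "B i = (THE V. V \<in> \<pi> \<and> i \<in> V)" for i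
  have B_eq: "B i = V" if "V \<in> \<pi>" "i \<in> V" for i V
    unfolding B_def using that partition_onD2[OF part]
    by (intro the_equality) (auto simp: disjoint_def)
  have B: "B i \<in> \<pi>" "i \<in> B i" if i: "i \<in> {1..n}" for i
  proof -
    obtain V where V: "V \<in> \<pi>" "i \<in> V" using i partition_onD1[OF part] by (metis UnionE)
    thus "B i \<in> \<pi>" "i \<in> B i" using B_eq[OF V] by simp_all
  qed
  have sub: "V \<subseteq> {1..n}" if "V \<in> \<pi>" for V using that partition_onD1[OF part] by blast
  have fin: "finite V" "V \<noteq> {}" if "V \<in> \<pi>" for V
    using sub[OF that] partition_onD3[OF part] that finite_subset by auto
  define w where "w = map (\<lambda>i. u (B (Suc i))) [0..<n]"
  have len: "length w = n" by (simp add: w_def)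
  have nth: "w ! i = u (B (Suc i))" if "i < n" for i using that by (simp add: w_def)
  have "B ` {1..n} = \<pi>"
  proof (intro equalityI subsetI)
    fix V assume V: "V \<in> \<pi>"
    then obtain i where "i \<in> V" using fin(2) by blast
    thus "V \<in> B ` {1..n}" using B_eq[OF V] sub[OF V] by (intro image_eqI[of _ _ i]) auto
  qed (use B in auto)
  moreover have "set w = u ` B ` Suc ` {0..<n}" unfolding w_def image_image by simp
  moreover have "Suc ` {0..<n} = {1..n}" by (simp add: image_Suc_atLeastLessThan atLeastLessThanSuc_atLeastAtMost)
  ultimately have set: "set w = u ` \<pi>" by simp
  hence set': "set w = {1..card \<pi>}" using bij by (simp add: bij_betw_def)
  have level: "level_set w (u V) = V" if V: "V \<in> \<pi>" for V
  proof (intro equalityI subsetI)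
    fix i assume "i \<in> level_set w (u V)"
    hence i: "i \<in> {1..n}" "u (B i) = u V"
      using nth[of "i - 1"] len by (auto simp: level_set_def)
    hence "B i = V" using bij V B(1)[OF i(1)] by (auto simp: bij_betw_def inj_on_def)
    thus "i \<in> V" using B i by blast
  next
    fix i assume i: "i \<in> V"
    hence i': "i \<in> {1..n}" using sub[OF V] by blast
    hence "w ! (i - 1) = u V" using nth[of "i - 1"] B_eq[OF V i] by auto
    thus "i \<in> level_set w (u V)" using i' len by (simp add: level_set_def)
  qed
  have "valley_free w"
    unfolding valley_free_iff_nth
  proof (intro allI impI, elim conjE)
    fix a b c assume *: "a < b" "b < c" "c < length w" "w ! a = w ! c"
    define V W where "V = B (Suc a)" and "W = B (Suc b)"
    have n: "Suc a \<in> {1..n}" "Suc b \<in> {1..n}" "Suc c \<in> {1..n}" using * len by auto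
    have V: "V \<in> \<pi>" "Suc a \<in> V" and W: "W \<in> \<pi>" "Suc b \<in> W"
      using B n unfolding V_def W_def by blast+
    have "u (B (Suc c)) = u V" using * len nth by (simp add: V_def)
    hence "B (Suc c) = V" using bij V B(1)[OF n(3)] by (auto simp: bij_betw_def inj_on_def)
    hence c: "Suc c \<in> V" using B n by blast
    have "u V \<le> u W"
    proof (cases "V = W")
      case False
      have m: "Min W \<in> W" "Max W \<in> W" using fin[OF W(1)] by auto
      \<comment> \<open>Otherwise \<open>Min W\<close>, \<open>Suc a\<close>, \<open>Suc b\<close>,
        \<open>Suc c\<close> alternate between W and V, a crossing; the bound on
        \<open>Max W\<close> is the mirror image.\<close>
      have "\<not> Min W < Suc a"
      proof
        assume "Min W < Suc a"
        thus False using nc False V W m c * unfolding noncrossing_def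
          by (metis Suc_less_eq)
      qed
      moreover have "\<not> Max W > Suc c"
      proof
        assume "Max W > Suc c"
        thus False using nc False V W m c * unfolding noncrossing_def
          by (metis Suc_less_eq)
      qed
      moreover have "Min W \<noteq> Suc a" "Max W \<noteq> Suc c"
        using False V c m W B_eq by metis+
      moreover have "Min V \<le> Suc a" "Max V \<ge> Suc c" using fin[OF V(1)] V c by auto
      ultimately have "nested_inside W V" unfolding nested_inside_def by linarith
      thus ?thesis using mono[OF W(1) V(1)] by simp
    qed simp
    thus "w ! a \<le> w ! b" using nth * len by (simp add: V_def W_def)
  qed
  hence "w \<in> words n" using len set' by (simp add: words_def)
  moreover have "partition_of w = (\<pi>, u)"
  proof -
    have \<pi>: "level_set w ` set w = \<pi>" using level by (simp add: set image_image)
    moreover have "restrict (\<lambda>V. w ! (Min V - 1)) \<pi> = u"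
    proof
      fix V show "restrict (\<lambda>V. w ! (Min V - 1)) \<pi> V = u V"
      proof (cases "V \<in> \<pi>")
        case True
        thus ?thesis using nth_Min_level_set[of "u V" w] level[OF True] set by simp
      qed (use ext in \<open>auto simp: extensional_def\<close>)
    qed
    ultimately show ?thesis by (simp add: partition_of_def)
  qed
  ultimately show ?thesis by force
qed

lemma bij_betw_partition_of: "bij_betw partition_of (words n) (NC_mton n)"
  unfolding bij_betw_def using inj_on_partition_of partition_of_words partition_of_surj by auto

lemma Y_partition_of: "Y (partition_of w) = card (set w)"
  by (simp add: Y_def partition_of_def card_image[OF level_set_inj])

section \<open>Mean and variance of the number of blocks\<close>

definition word_mean :: "(nat \<Rightarrow> real) \<Rightarrow> nat \<Rightarrow> real" where
  "word_mean g n = (\<Sum>w\<in>words n. g (card (set w))) / real (card (words n))"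

lemma card_words_pos: "n > 0 \<Longrightarrow> card (words n) > 0"
  using bij_betw_same_card[OF bij_betw_partition_of] NC_mton_nonempty[of n] finite_NC_mton[of n]
  by (simp add: card_gt_0_iff)

lemma expectation_NC_mton:
  fixes g :: "nat \<Rightarrow> real"
  assumes "n > 0"
  shows "measure_pmf.expectation (pmf_of_set (NC_mton n)) (\<lambda>x. g (Y x)) = word_mean g n"
proof -
  have "measure_pmf.expectation (pmf_of_set (NC_mton n)) (\<lambda>x. g (Y x)) =
      (\<Sum>x\<in>NC_mton n. g (Y x)) / real (card (NC_mton n))"
    using NC_mton_nonempty[of n] finite_NC_mton assms by (subst integral_pmf_of_set) auto
  also have "(\<Sum>x\<in>NC_mton n. g (Y x)) = (\<Sum>w\<in>words n. g (card (set w)))"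
    by (simp add: sum.reindex_bij_betw[OF bij_betw_partition_of, symmetric] Y_partition_of)
  finally show ?thesis
    by (simp add: word_mean_def bij_betw_same_card[OF bij_betw_partition_of])
qed

lemma word_mean_add: "word_mean (\<lambda>k. f k + g k) n = word_mean f n + word_mean g n"
  by (simp add: word_mean_def sum.distrib add_divide_distrib)

lemma word_mean_cmult: "word_mean (\<lambda>k. c * f k) n = c * word_mean f n"
  by (simp add: word_mean_def flip: sum_distrib_left)

lemma word_mean_const: "n > 0 \<Longrightarrow> word_mean (\<lambda>_. c) n = c"
  using card_words_pos[of n] by (simp add: word_mean_def)

text \<open>Each word of length n has one extension with as many distinct letters and n + 1
  extensions with one more; this is the Bernoulli increment with parameter (n + 1) / (n +
  2).\<close>

lemma word_mean_Suc:
  assumes "n > 0"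
  shows "word_mean g (Suc n) =
    (word_mean g n + (real n + 1) * word_mean (\<lambda>k. g (Suc k)) n) / (real n + 2)"
proof -
  \<comment> \<open>Weight 1 in the recursion counts the words.\<close>
  have "real (card (words (Suc n))) = (real n + 2) * real (card (words n))"
    using sum_words_Suc[OF assms, of "\<lambda>_. 1"] by (simp add: algebra_simps)
  thus ?thesis
    using card_words_pos[OF assms]
    by (simp add: word_mean_def sum_words_Suc[OF assms] sum.distrib field_simps flip: sum_distrib_left)
qed

text \<open>For n \<ge> 1 this is 1 plus the sum of the Bernoulli means k / (k + 1) over k =
  2..n.\<close>

definition mean_value :: "nat \<Rightarrow> real" where
  "mean_value n = real n - harm n + 3 / 2 - 1 / (real n + 1)"

text \<open>For n \<ge> 1 this is the sum of the Bernoulli variances k / (k + 1)^2 over k = 2..n;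
  the rational term collects the boundary terms of the shifted harmonic sums.\<close>

definition variance_value :: "nat \<Rightarrow> real" where
  "variance_value n = harm n - harm2 n - (real n - 1)\<^sup>2 / (4 * (real n + 1)\<^sup>2)"

lemma mean_value_Suc: "mean_value (Suc n) = mean_value n + (real n + 1) / (real n + 2)"
  by (simp add: mean_value_def harm_Suc divide_simps) (simp add: algebra_simps)

lemma variance_value_Suc:
  "variance_value (Suc n) = variance_value n +
    (real n + 1) / (real n + 2) - ((real n + 1) / (real n + 2))\<^sup>2"
proof -
  define x where "x = real n"
  have nz: "x + 1 \<noteq> 0" "x + 2 \<noteq> 0" by (simp_all add: x_def add_nonneg_eq_0_iff)
  have "1 / (x + 1) - 1 / (x + 1)\<^sup>2 - x\<^sup>2 / (4 * (x + 2)\<^sup>2) =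
     - ((x - 1)\<^sup>2 / (4 * (x + 1)\<^sup>2)) + (x + 1) / (x + 2) - ((x + 1) / (x + 2))\<^sup>2"
    using nz by (simp add: divide_simps power_divide) algebra
  thus ?thesis
    by (simp add: variance_value_def harm_Suc harm2_def x_def inverse_eq_divide algebra_simps)
qed

text \<open>The recursion is linear in the weight, so it is the raw second moment rather than the
  variance that is carried through the induction. It starts from the single word of length
  1.\<close>

lemma word_mean_moments:
  assumes "n \<ge> 1"
  shows "word_mean real n = mean_value n \<and>
    word_mean (\<lambda>k. (real k)\<^sup>2) n = variance_value n + (mean_value n)\<^sup>2"
  using assms
proof (induction n rule: dec_induct)
  case base
  show ?case
    unfolding One_nat_def[symmetric]
    by (simp add: word_mean_def words_1[unfolded One_nat_def] mean_value_def variance_value_def harm2_def harm_def)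
next
  case (step n)
  hence n: "n > 0" by simp
  note lin = word_mean_add word_mean_cmult word_mean_const[OF n]
  define q where "q = (real n + 1) / (real n + 2)"
  have nz: "real n + 2 \<noteq> 0" by (simp add: add_nonneg_eq_0_iff)
  \<comment> \<open>Here x is the old moment and y the mean gain when a letter is added: 1 for the
    first moment, twice the mean plus 1 for the second.\<close>
  have q: "(x + (real n + 1) * (x + y)) / (real n + 2) = x + q * y" for x y
    using nz by (simp add: q_def field_simps)
  have "word_mean (\<lambda>k. real (Suc k)) n = word_mean (\<lambda>k. real k + 1) n" by (simp add: add.commute)
  also have "\<dots> = word_mean real n + 1" using lin(1)[of real] lin(3) by simp
  finally have 1: "word_mean real (Suc n) = word_mean real n + q"
    unfolding word_mean_Suc[OF n] using q[of _ 1] by simp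
  have "word_mean (\<lambda>k. (real (Suc k))\<^sup>2) n = word_mean (\<lambda>k. (real k)\<^sup>2 + (2 * real k + 1)) n"
    by (simp add: power2_eq_square algebra_simps)
  also have "\<dots> = word_mean (\<lambda>k. (real k)\<^sup>2) n + (2 * word_mean real n + 1)"
    by (simp only: lin)
  finally have 2: "word_mean (\<lambda>k. (real k)\<^sup>2) (Suc n) =
      word_mean (\<lambda>k. (real k)\<^sup>2) n + q * (2 * word_mean real n + 1)"
    unfolding word_mean_Suc[OF n] using q by simp
  show ?case
    unfolding 1 2 mean_value_Suc variance_value_Suc q_def[symmetric]
    using step.IH by (simp add: power2_eq_square algebra_simps)
qed

lemma EY_eq: "n \<ge> 1 \<Longrightarrow> EY n = mean_value n"
  unfolding EY_def by (subst expectation_NC_mton) (auto simp: word_mean_moments)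

lemma VarY_eq:
  assumes "n \<ge> 1"
  shows "VarY n = variance_value n"
proof -
  define e where "e = mean_value n"
  have n: "n > 0" using assms by simp
  have "VarY n = word_mean (\<lambda>k. (real k - e)\<^sup>2) n"
    unfolding VarY_def EY_def[symmetric] EY_eq[OF assms]
    by (subst expectation_NC_mton[OF n, of "\<lambda>k. (real k - e)\<^sup>2", symmetric]) (simp add: e_def)
  also have "(\<lambda>k. (real k - e)\<^sup>2) = (\<lambda>k. (real k)\<^sup>2 + ((- 2 * e) * real k + e\<^sup>2))"
    by (simp add: power2_eq_square algebra_simps)
  also have "word_mean \<dots> n = word_mean (\<lambda>k. (real k)\<^sup>2) n + ((- 2 * e) * word_mean real n + e\<^sup>2)"
    by (simp only: word_mean_add word_mean_cmult word_mean_const[OF n])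
  also have "\<dots> = variance_value n"
    using word_mean_moments[OF assms] by (simp add: e_def power2_eq_square)
  finally show ?thesis .
qed

section \<open>Asymptotics\<close>

text \<open>Euler's value of the series of inverse squares, reindexed to start at 1.\<close>

lemma harm2_tendsto: "harm2 \<longlonglongrightarrow> pi\<^sup>2 / 6"
proof -
  have "(\<lambda>n. \<Sum>k<n. 1 / real (Suc k) ^ 2) \<longlonglongrightarrow> pi\<^sup>2 / 6"
    using inverse_squares_sums by (simp add: sums_def)
  moreover have "(\<Sum>k<n. 1 / real (Suc k) ^ 2) = harm2 n" for n
    unfolding harm2_def by (rule sum.reindex_bij_witness[of _ "\<lambda>k. k - 1" Suc]) auto
  ultimately show ?thesis by simp
qed

lemma seq_approx_cong:
  assumes "\<And>n. n \<ge> 1 \<Longrightarrow> a n = a' n" and "seq_approx a' b"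
  shows "seq_approx a b"
  using assms(2) unfolding seq_approx_def
  by (rule Lim_transform_eventually)
     (auto intro!: eventually_mono[OF eventually_ge_at_top[of 1]] simp: assms(1))

lemma mean_value_approx:
  "seq_approx mean_value (\<lambda>n. (real n - ln (real n)) + (3 / 2 - euler_mascheroni))"
proof -
  have "(\<lambda>n. - (harm n - ln (real n)) + euler_mascheroni - 1 / (real n + 1))
      \<longlonglongrightarrow> - euler_mascheroni + euler_mascheroni - (0 :: real)"
  proof (intro tendsto_intros euler_mascheroni_LIMSEQ)
    show "(\<lambda>n. 1 / (real n + 1)) \<longlonglongrightarrow> 0" by real_asymp
  qed
  thus ?thesis unfolding seq_approx_def mean_value_def by (simp add: algebra_simps)
qed

text \<open>The constant combines three limits: \<open>harm n - ln (real n)\<close> tends to the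
  Euler-Mascheroni constant, \<open>harm2\<close> to the Basel value, and the rational term to
  1/4.\<close>

lemma variance_value_approx:
  "seq_approx variance_value (\<lambda>n. ln (real n) - (pi\<^sup>2 / 6 + 1 / 4 - euler_mascheroni))"
proof -
  have "(\<lambda>n. (harm n - ln (real n)) - harm2 n - (real n - 1)\<^sup>2 / (4 * (real n + 1)\<^sup>2) +
        (pi\<^sup>2 / 6 + 1 / 4 - euler_mascheroni))
      \<longlonglongrightarrow> euler_mascheroni - pi\<^sup>2 / 6 - 1 / 4 + (pi\<^sup>2 / 6 + 1 / 4 - euler_mascheroni)"
  proof (intro tendsto_add tendsto_diff tendsto_const euler_mascheroni_LIMSEQ harm2_tendsto)
    show "(\<lambda>n. (real n - 1)\<^sup>2 / (4 * (real n + 1)\<^sup>2)) \<longlonglongrightarrow> 1 / 4" by real_asymp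
  qed
  moreover have "variance_value n - (ln (real n) - (pi\<^sup>2 / 6 + 1 / 4 - euler_mascheroni)) =
      (harm n - ln (real n)) - harm2 n - (real n - 1)\<^sup>2 / (4 * (real n + 1)\<^sup>2) +
        (pi\<^sup>2 / 6 + 1 / 4 - euler_mascheroni)" for n
    by (simp add: variance_value_def)
  moreover have "euler_mascheroni - pi\<^sup>2 / 6 - 1 / 4 + (pi\<^sup>2 / 6 + 1 / 4 - euler_mascheroni) = (0 :: real)"
    by simp
  ultimately show ?thesis unfolding seq_approx_def by (simp only:)
qed

theorem theorem1p6:
  shows "((\<forall>n\<ge>2. EY n = real n - harm n + 3 / 2 - 1 / (real n + 1)) \<and>
          seq_approx EY (\<lambda>n. (real n - ln (real n)) + (3 / 2 - euler_mascheroni))) \<and>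
         ((\<forall>n\<ge>2. VarY n = harm n - harm2 n - (real n - 1)\<^sup>2 / (4 * (real n + 1)\<^sup>2)) \<and>
          seq_approx VarY (\<lambda>n. ln (real n) - (pi\<^sup>2 / 6 + 1 / 4 - euler_mascheroni)))"
proof (intro conjI allI impI)
  show "seq_approx EY (\<lambda>n. (real n - ln (real n)) + (3 / 2 - euler_mascheroni))"
    using EY_eq mean_value_approx by (rule seq_approx_cong)
  show "seq_approx VarY (\<lambda>n. ln (real n) - (pi\<^sup>2 / 6 + 1 / 4 - euler_mascheroni))"
    using VarY_eq variance_value_approx by (rule seq_approx_cong)
qed (simp_all add: EY_eq VarY_eq mean_value_def variance_value_def)

end
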